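(* Let $q=1$, $d\in\mathbb N$, $T>0$, and let $\|\cdot\|$ be a fixed norm on $\mathbb R^d$. Consider the Gaussian ODE filter with once integrated Brownian motion prior (defined in the context) with step size $h>0$, $T/h\in\mathbb N$, applied to $\dot x(t)=f(x(t))$ on $[0,T]$, $x(0)=x_0\in\mathbb R^d$. Assume: (A1) $f\in C^1(\mathbb R^d;\mathbb R^d)$ and there is $L>0$ such that $\|D^\alpha f\|_\infty\le L$ for all multi-indices $\alpha\in\mathbb N_0^d$ with $\sum_i\alpha_i=1$, and $\|D^\alpha f(a)-D^\alpha f(b)\|\le L\|a-b\|$ for all $a,b\in\mathbb R^d$ and all $\alpha$ with $0\le\sum_i\alpha_i\le1$. (A2) $\|P(0)_{k,l}\|\le K_0h^{3-k-l}$ for all $k,l\in\{0,1\}$. (A3) $\|m^{(i)}(0)-x^{(i)}(0)\|\le K_0h^{2-i}$ for $i\in\{0,1\}$. (A4) The measurement variance is $R\equiv K_Rh^p$ with a constant $K_R>0$ independent of $h$ and some $p\in[1,\infty]$, where $K_Rh^\infty:=0$. Here $K_0>0$ is a constant independent of $h$ (the initial values $\boldsymbol m(0),P(0)$ may depend on $h$). Then there is a constant $K(T)>0$, which depends on $T$ but not on $h$, such that for all sufficiently small $h>0$ $$\max_{n\in\{0,\dots,T/h\}}\left\|\varepsilon^{(0)}(nh)\right\|\le\max_{n\in\{0,\dots,T/h\}}|||\boldsymbol\varepsilon(nh)|||_h\le K(T)\,h.$$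
   Context: Indices start at $0$. The exact solution is $x=x^{(0)}$, $x^{(1)}=\dot x$, $\boldsymbol x=(x^{(0)},x^{(1)})^\intercal\in\mathbb R^{2\times d}$. Filter ($q=1$, integrated Brownian motion prior). For each coordinate $j\in\{0,\dots,d-1\}$ fix a scale $\sigma_j>0$ and put $$A(h)=\begin{pmatrix}1&h\\ 0&1\end{pmatrix},\qquad Q_j(h)=\sigma_j^2\begin{pmatrix}h^3/3&h^2/2\\ h^2/2&h\end{pmatrix}.$$ The state at time $t=nh$ is a mean $\boldsymbol m(t)=(m^{(0)}(t),m^{(1)}(t))^\intercal\in\mathbb R^{2\times d}$ with rows $m^{(i)}(t)\in\mathbb R^d$, and a symmetric positive semidefinite matrix $P_j(t)\in\mathbb R^{2\times2}$ for each coordinate $j$; $P(t)_{k,l}\in\mathbb R^d$ denotes the vector with components $(P_j(t))_{k,l}$. One step $t\to t+h$ is: prediction $\boldsymbol m^-(t+h)=A(h)\boldsymbol m(t)$, $P_j^-(t+h)=A(h)P_j(t)A(h)^\intercal+Q_j(h)$; residual $r(t+h)=f(m^{-,(0)}(t+h))-m^{-,(1)}(t+h)\in\mathbb R^d$; gains $\beta_j^{(i)}(t+h)=\dfrac{(P^-_j(t+h))_{i1}}{(P_j^-(t+h))_{11}+R}$, $i=0,1$; update $m^{(i)}_j(t+h)=m_j^{-,(i)}(t+h)+\beta_j^{(i)}(t+h)r_j(t+h)$ and $P_j(t+h)=P_j^-(t+h)-\dfrac{(P_j^-(t+h))_{:,1}(P_j^-(t+h))_{1,:}}{(P_j^-(t+h))_{11}+R}$.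 Error and norm. $\boldsymbol\varepsilon(nh)=(\varepsilon^{(0)}(nh),\varepsilon^{(1)}(nh))^\intercal:=\boldsymbol m(nh)-\boldsymbol x(nh)$, and for $a\in\mathbb R^{2\times d}$ with rows $a_{0,:},a_{1,:}$, $|||a|||_h:=\|a_{0,:}\|+h\|a_{1,:}\|$. "Sufficiently small $h$" is with all other data fixed. *)

theory Defs
  imports "HOL-Analysis.Analysis"
begin

definition is_norm :: "('a::real_vector \<Rightarrow> real) \<Rightarrow> bool" where
  "is_norm N \<longleftrightarrow>
     (\<forall>x. 0 \<le> N x) \<and> (\<forall>x. N x = 0 \<longleftrightarrow> x = 0) \<and>
     (\<forall>c x. N (c *\<^sub>R x) = \<bar>c\<bar> * N x) \<and> (\<forall>x y. N (x + y) \<le> N x + N y)"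

definition C1_map :: "('a::real_normed_vector \<Rightarrow> 'b::real_normed_vector) \<Rightarrow> bool" where
  "C1_map f \<longleftrightarrow>
     (\<exists>f'. (\<forall>x. (f has_derivative blinfun_apply (f' x)) (at x)) \<and> continuous_on UNIV f')"

text \<open>The multi-indices of order one are the unit multi-indices, so these are all the \<open>D\<^sup>\<alpha> f\<close>
  of order one; the only one of order zero is \<open>f\<close> itself.\<close>

definition partial_deriv ::
    "'d::finite \<Rightarrow> (real^'d \<Rightarrow> 'b::real_normed_vector) \<Rightarrow> real^'d \<Rightarrow> 'b" where
  "partial_deriv i f a = vector_derivative (\<lambda>s. f (a + s *\<^sub>R axis i 1)) (at 0)"

text \<open>Rows and columns are indexed by the type \<open>2\<close>, whose elements are \<open>0\<close> and \<open>1\<close>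
  (and \<open>2 = 0\<close>). Index \<open>0\<close> is the solution component, index \<open>1\<close> its derivative.
  The library function \<open>vector\<close> numbers entries from \<open>1\<close>, so it is avoided here.\<close>

definition mat22 :: "real \<Rightarrow> real \<Rightarrow> real \<Rightarrow> real \<Rightarrow> real^2^2" where
  "mat22 a b c d = (\<chi> i k. if i = 0 then (if k = 0 then a else b) else (if k = 0 then c else d))"

definition rows2 :: "real^'d \<Rightarrow> real^'d \<Rightarrow> real^'d^2" where
  "rows2 u v = (\<chi> i. if i = 0 then u else v)"

definition sym_psd :: "real^'n^'n \<Rightarrow> bool" where
  "sym_psd P \<longleftrightarrow> transpose P = P \<and> (\<forall>v. 0 \<le> v \<bullet> (P *v v))"

definition trans_mat :: "real \<Rightarrow> real^2^2" where
  "trans_mat h = mat22 1 h 0 1"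

definition diff_mat :: "real \<Rightarrow> real \<Rightarrow> real^2^2" where
  "diff_mat s h = s\<^sup>2 *\<^sub>R mat22 (h^3 / 3) (h\<^sup>2 / 2) (h\<^sup>2 / 2) h"

definition pred_mean :: "real \<Rightarrow> real^'d^2 \<Rightarrow> real^'d^2" where
  "pred_mean h m = trans_mat h ** m"

definition pred_cov :: "real \<Rightarrow> real \<Rightarrow> real^2^2 \<Rightarrow> real^2^2" where
  "pred_cov s h P = trans_mat h ** P ** transpose (trans_mat h) + diff_mat s h"

text \<open>In the following three functions the argument is a predicted mean or covariance.\<close>

definition residual :: "(real^'d \<Rightarrow> real^'d) \<Rightarrow> real^'d^2 \<Rightarrow> real^'d" where
  "residual f m = f (m $ 0) - m $ 1"

definition gain :: "real \<Rightarrow> real^2^2 \<Rightarrow> real^2" where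
  "gain R P = (\<chi> i. P $ i $ 1 / (P $ 1 $ 1 + R))"

definition update_cov :: "real \<Rightarrow> real^2^2 \<Rightarrow> real^2^2" where
  "update_cov R P = P - (\<chi> i k. P $ i $ 1 * P $ 1 $ k / (P $ 1 $ 1 + R))"

definition filter_step ::
    "(real^'d \<Rightarrow> real^'d) \<Rightarrow> ('d \<Rightarrow> real) \<Rightarrow> real \<Rightarrow> real \<Rightarrow>
     (real^'d^2) \<times> ('d \<Rightarrow> real^2^2) \<Rightarrow> (real^'d^2) \<times> ('d \<Rightarrow> real^2^2)" where
  "filter_step f \<sigma> R h S =
     (let mp = pred_mean h (fst S);
          Pp = (\<lambda>j. pred_cov (\<sigma> j) h (snd S j));
          r = residual f mp
      in (\<chi> i j. mp $ i $ j + gain R (Pp j) $ i * r $ j,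
          \<lambda>j. update_cov R (Pp j)))"

definition filter_state ::
    "(real^'d \<Rightarrow> real^'d) \<Rightarrow> ('d \<Rightarrow> real) \<Rightarrow> real \<Rightarrow> real \<Rightarrow>
     real^'d^2 \<Rightarrow> ('d \<Rightarrow> real^2^2) \<Rightarrow> nat \<Rightarrow> (real^'d^2) \<times> ('d \<Rightarrow> real^2^2)" where
  "filter_state f \<sigma> R h m0 P0 n = (filter_step f \<sigma> R h ^^ n) (m0, P0)"

definition cov_entry :: "('d \<Rightarrow> real^2^2) \<Rightarrow> 2 \<Rightarrow> 2 \<Rightarrow> real^'d" where
  "cov_entry P k l = (\<chi> j. P j $ k $ l)"

text \<open>\<open>K\<^sub>R h\<^sup>p\<close> with \<open>p\<close> in \<open>[1, \<infinity>]\<close> and the convention \<open>K\<^sub>R h\<^sup>\<infinity> = 0\<close>.\<close>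

definition meas_var :: "real \<Rightarrow> ereal \<Rightarrow> real \<Rightarrow> real" where
  "meas_var KR p h = (if p = \<infinity> then 0 else KR * h powr real_of_ereal p)"

definition step_norm :: "(real^'d \<Rightarrow> real) \<Rightarrow> real \<Rightarrow> real^'d^2 \<Rightarrow> real" where
  "step_norm N h a = N (a $ 0) + h * N (a $ 1)"

definition filter_error ::
    "(real^'d \<Rightarrow> real^'d) \<Rightarrow> ('d \<Rightarrow> real) \<Rightarrow> real \<Rightarrow> real \<Rightarrow>
     real^'d^2 \<Rightarrow> ('d \<Rightarrow> real^2^2) \<Rightarrow> (real \<Rightarrow> real^'d) \<Rightarrow> (real \<Rightarrow> real^'d) \<Rightarrow> nat \<Rightarrow> real^'d^2" where
  "filter_error f \<sigma> R h m0 P0 x x' n =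
     fst (filter_state f \<sigma> R h m0 P0 n) - rows2 (x (real n * h)) (x' (real n * h))"

end

theory Submission
  imports Defs
begin

text \<open>Because \<open>R \<le> K\<^sub>R h\<close> while each prediction adds at least \<open>\<sigma>\<^sub>j\<^sup>2 h\<close> to the predicted variance of
  the derivative, the gains satisfy \<open>0 \<le> 1 - \<beta>\<^sup>(\<^sup>1\<^sup>) \<le> \<rho> < 1\<close> and \<open>\<beta>\<^sup>(\<^sup>0\<^sup>) = O(h)\<close> uniformly in time.
  Hence the defect \<open>f m\<^sup>(\<^sup>0\<^sup>) - m\<^sup>(\<^sup>1\<^sup>)\<close> is contracted by each update, up to \<open>O(h)\<close>, and the error of
  \<open>m\<^sup>(\<^sup>0\<^sup>)\<close> follows a perturbed Euler recursion; a weighted sum of the two obeys a discrete Gronwall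
  inequality. The Euclidean norm is used throughout, because the gains differ between coordinates
  and multiplication by a diagonal matrix with entries at most \<open>\<rho>\<close> need not contract \<open>N\<close>.\<close>

section \<open>Equivalence of norms in finite dimension\<close>

text \<open>Expansion in the basis gives the upper bound, which makes \<open>N\<close> Lipschitz.
  Hence \<open>N\<close> attains its minimum on the compact unit sphere; this minimum is positive,
  and its reciprocal serves as \<open>c\<close>.\<close>

lemma is_norm_equivalent:
  fixes N :: "'a::euclidean_space \<Rightarrow> real"
  assumes "is_norm N"
  shows "\<exists>c>0. \<exists>C>0. \<forall>x. norm x \<le> c * N x \<and> N x \<le> C * norm x"
proof -
  have nonneg: "0 \<le> N x" and eq_0: "N x = 0 \<longleftrightarrow> x = 0"
    and scale: "N (a *\<^sub>R x) = \<bar>a\<bar> * N x" and triangle: "N (x + y) \<le> N x + N y" for a x y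
    using assms unfolding is_norm_def by blast+
  have N_sum: "N (sum g A) \<le> (\<Sum>i\<in>A. N (g i))" if "finite A" for A :: "'a set" and g
    using that
  proof (induction A rule: finite_induct)
    case empty
    show ?case using eq_0[of 0] by simp
  next
    case (insert i A)
    then show ?case using triangle[of "g i" "sum g A"] by simp
  qed
  define C where "C = (\<Sum>i\<in>Basis. N (i::'a)) + 1"
  have "C > 0" unfolding C_def by (simp add: add_nonneg_pos nonneg sum_nonneg)
  have upper: "N x \<le> C * norm x" for x
  proof -
    have "N x = N (\<Sum>i\<in>Basis. (x \<bullet> i) *\<^sub>R i)" by (simp add: euclidean_representation)
    also have "\<dots> \<le> (\<Sum>i\<in>Basis. N ((x \<bullet> i) *\<^sub>R i))" by (simp add: N_sum)
    also have "\<dots> = (\<Sum>i\<in>Basis. \<bar>x \<bullet> i\<bar> * N i)" by (simp add: scale)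
    also have "\<dots> \<le> (\<Sum>i\<in>Basis. norm x * N i)"
      by (intro sum_mono mult_right_mono nonneg Basis_le_norm)
    also have "\<dots> \<le> C * norm x" 
      by (simp add: C_def sum_distrib_left distrib_left mult.commute[of _ "norm x"])
    finally show ?thesis .
  qed
  have "N x - N y \<le> C * norm (x - y)" for x y
    using triangle[of "x - y" y] upper[of "x - y"] by simp
  then have "C-lipschitz_on UNIV N"
    using \<open>C > 0\<close> by (intro lipschitz_onI) (auto simp: dist_norm abs_le_iff norm_minus_commute, smt (verit) norm_minus_commute)
  then have "continuous_on (sphere 0 1) N"
    by (meson continuous_on_subset lipschitz_on_continuous_on subset_UNIV)
  moreover have "sphere 0 1 \<noteq> ({} :: 'a set)" by simp
  ultimately obtain z where z: "z \<in> sphere 0 1" "\<And>y. y \<in> sphere 0 1 \<Longrightarrow> N z \<le> N y"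
    using continuous_attains_inf[of "sphere 0 1 :: 'a set" N] by auto
  have "z \<noteq> 0" using z(1) by auto
  then have "N z > 0" using nonneg[of z] eq_0[of z] by linarith
  have "norm x \<le> 1 / N z * N x" for x
  proof (cases "x = 0")
    case False
    then have "N z \<le> N ((1 / norm x) *\<^sub>R x)" by (intro z(2)) simp
    then show ?thesis using \<open>N z > 0\<close> False by (simp add: scale field_simps)
  qed (use eq_0[of 0] in simp)
  with upper \<open>C > 0\<close> \<open>N z > 0\<close> show ?thesis
    by (intro exI[of _ "1 / N z"] exI[of _ C] conjI) auto
qed

section \<open>Kalman gains\<close>

lemma UNIV_2_eq: "(UNIV :: 2 set) = {0, 1}"
proof -
  have "x = 1 \<or> x = 0" for x :: 2 using exhaust_2[of x] by auto
  then show ?thesis by blast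
qed

text \<open>The gain reads only the column with index 1. The two entries of this column evolve
  without the (0,0) entry, so the covariance recursion closes on them.\<close>

lemma pred_cov_entries:
  "pred_cov s h P $ 1 $ 1 = P $ 1 $ 1 + s\<^sup>2 * h"
  "pred_cov s h P $ 0 $ 1 = P $ 0 $ 1 + h * P $ 1 $ 1 + s\<^sup>2 * h\<^sup>2 / 2"
  by (simp_all add: pred_cov_def trans_mat_def diff_mat_def mat22_def matrix_matrix_mult_def
      transpose_def UNIV_2_eq)

text \<open>The factor equals \<open>1 - gain R P $ 1\<close>, so the covariance column and the
  defect are multiplied by the same number.\<close>

lemma update_cov_entry:
  assumes "P $ 1 $ 1 + R \<noteq> 0"
  shows "update_cov R P $ i $ 1 = R / (P $ 1 $ 1 + R) * P $ i $ 1"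
  using assms by (simp add: update_cov_def field_simps)

text \<open>The predicted variance is at least \<open>s1\<^sup>2 * h\<close> and \<open>R\<close> is
  at most \<open>KR * h\<close>, whence the contraction factor \<open>\<rho>\<close>. The premise on
  \<open>B\<close> says that this contraction makes up for the growth of the cross covariance in the
  prediction.\<close>

lemma cov_step_bounds:
  fixes s1 s2 KR K B h R s :: real
  defines "\<rho> \<equiv> KR / (s1\<^sup>2 + KR)"
  assumes "0 < s1" "s1 \<le> s" "s \<le> s2" "0 < KR" "0 < h" "0 \<le> R" "R \<le> KR * h"
    and "KR \<le> K"
    and B: "\<rho> * (B + K + s2\<^sup>2 / 2) \<le> B"
    and P: "0 \<le> P $ 1 $ 1" "P $ 1 $ 1 \<le> K * h" "\<bar>P $ 0 $ 1\<bar> \<le> B * h\<^sup>2"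
  defines "Pp \<equiv> pred_cov s h P"
  shows "0 \<le> 1 - gain R Pp $ 1" "1 - gain R Pp $ 1 \<le> \<rho>"
    and "\<bar>gain R Pp $ 0\<bar> \<le> (B + K + s2\<^sup>2 / 2) / s1\<^sup>2 * h"
    and "0 \<le> update_cov R Pp $ 1 $ 1" "update_cov R Pp $ 1 $ 1 \<le> K * h"
    and "\<bar>update_cov R Pp $ 0 $ 1\<bar> \<le> B * h\<^sup>2"
proof -
  have "s1\<^sup>2 \<le> s\<^sup>2" "s\<^sup>2 \<le> s2\<^sup>2" using assms by (simp_all add: power_mono)
  have "0 < s1\<^sup>2" using \<open>0 < s1\<close> by simp
  define a where "a = Pp $ 1 $ 1"
  define b where "b = Pp $ 0 $ 1"
  have "s1\<^sup>2 * h \<le> s\<^sup>2 * h" using \<open>s1\<^sup>2 \<le> s\<^sup>2\<close> \<open>0 < h\<close> by simp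
  then have a_ge: "s1\<^sup>2 * h \<le> a" using P(1) by (simp add: a_def Pp_def pred_cov_entries)
  have "0 < s1\<^sup>2 * h" using \<open>0 < s1\<^sup>2\<close> \<open>0 < h\<close> by simp
  with a_ge have "0 < a" by linarith
  with \<open>0 \<le> R\<close> have "0 < a + R" by linarith
  have "\<bar>b\<bar> \<le> \<bar>P $ 0 $ 1\<bar> + h * P $ 1 $ 1 + s\<^sup>2 * h\<^sup>2 / 2"
    using P(1) \<open>0 < h\<close> abs_triangle_ineq[of "P $ 0 $ 1" "h * P $ 1 $ 1 + s\<^sup>2 * h\<^sup>2 / 2"]
    by (simp add: b_def Pp_def pred_cov_entries add.assoc)
  also have "\<dots> \<le> B * h\<^sup>2 + h * (K * h) + s2\<^sup>2 * h\<^sup>2 / 2"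
    using P(2,3) \<open>0 < h\<close> \<open>s\<^sup>2 \<le> s2\<^sup>2\<close>
    by (intro add_mono mult_left_mono divide_right_mono mult_right_mono) auto
  also have "\<dots> = (B + K + s2\<^sup>2 / 2) * h\<^sup>2" by (simp add: power2_eq_square algebra_simps)
  finally have b_le: "\<bar>b\<bar> \<le> (B + K + s2\<^sup>2 / 2) * h\<^sup>2" .
  define q where "q = R / (a + R)"
  have "0 \<le> q" using \<open>0 \<le> R\<close> \<open>0 < a\<close> by (simp add: q_def)
  \<comment> \<open>The upper bound on \<open>R\<close> and the lower bound on \<open>a\<close>
    combine into the cross-multiplied form of \<open>q \<le> \<rho>\<close>, from which
    \<open>h\<close> drops out.\<close>
  have "R * s1\<^sup>2 \<le> (KR * h) * s1\<^sup>2"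
    using assms by (intro mult_right_mono) auto
  also have "\<dots> \<le> KR * a" using mult_left_mono[OF a_ge, of KR] \<open>0 < KR\<close> by (simp add: mult_ac)
  finally have "R * (s1\<^sup>2 + KR) \<le> KR * (a + R)" by (simp add: algebra_simps)
  moreover have "0 < s1\<^sup>2 + KR" using \<open>0 < KR\<close> \<open>0 < s1\<^sup>2\<close> by linarith
  ultimately have "q \<le> \<rho>"
    using \<open>0 < a + R\<close> unfolding q_def \<rho>_def
    by (simp add: pos_divide_le_eq pos_le_divide_eq)
  have gain1: "1 - gain R Pp $ 1 = q"
    using \<open>0 < a + R\<close> by (simp add: gain_def a_def[symmetric] q_def field_simps)
  show "0 \<le> 1 - gain R Pp $ 1" "1 - gain R Pp $ 1 \<le> \<rho>"
    using gain1 \<open>0 \<le> q\<close> \<open>q \<le> \<rho>\<close> by simp_all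
  \<comment> \<open>A numerator of order \<open>h\<^sup>2\<close> meets a denominator of order at
    least \<open>h\<close>, also when \<open>R = 0\<close>.\<close>
  have "\<bar>gain R Pp $ 0\<bar> = \<bar>b\<bar> / (a + R)"
    using \<open>0 < a + R\<close> by (simp add: gain_def a_def[symmetric] b_def[symmetric])
  also have "\<dots> \<le> ((B + K + s2\<^sup>2 / 2) * h\<^sup>2) / (s1\<^sup>2 * h)"
    using b_le a_ge \<open>0 \<le> R\<close> \<open>0 < s1\<^sup>2 * h\<close> by (intro frac_le) auto
  also have "\<dots> = (B + K + s2\<^sup>2 / 2) / s1\<^sup>2 * h"
    using \<open>0 < h\<close> by (simp add: power2_eq_square)
  finally show "\<bar>gain R Pp $ 0\<bar> \<le> (B + K + s2\<^sup>2 / 2) / s1\<^sup>2 * h" .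
  have upd: "update_cov R Pp $ 1 $ 1 = q * a" "update_cov R Pp $ 0 $ 1 = q * b"
    using \<open>0 < a + R\<close> update_cov_entry[of Pp R] by (simp_all add: a_def b_def q_def)
  show "0 \<le> update_cov R Pp $ 1 $ 1" using upd \<open>0 \<le> q\<close> \<open>0 < a\<close> by simp
  \<comment> \<open>An update leaves a variance of at most \<open>R\<close>, however large the
    predicted one was.\<close>
  have "q * a \<le> R"
    using \<open>0 < a + R\<close> \<open>0 \<le> R\<close> by (simp add: q_def field_simps)
  also have "\<dots> \<le> KR * h" by fact
  also have "\<dots> \<le> K * h" using \<open>KR \<le> K\<close> \<open>0 < h\<close> by simp
  finally show "update_cov R Pp $ 1 $ 1 \<le> K * h" using upd by simp
  have "\<bar>q * b\<bar> \<le> \<rho> * ((B + K + s2\<^sup>2 / 2) * h\<^sup>2)"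
    unfolding abs_mult using \<open>0 \<le> q\<close> \<open>q \<le> \<rho>\<close> b_le by (intro mult_mono) auto
  also have "\<dots> \<le> B * h\<^sup>2" using mult_right_mono[OF B, of "h\<^sup>2"] by (simp add: mult.assoc)
  finally show "\<bar>update_cov R Pp $ 0 $ 1\<bar> \<le> B * h\<^sup>2" using upd by simp
qed

text \<open>The covariances depend neither on the mean nor on other coordinates, so the gains can be
  bounded before the mean is considered.\<close>

lemma snd_filter_state:
  "snd (filter_state f \<sigma> R h m0 P0 n) j =
    ((\<lambda>P. update_cov R (pred_cov (\<sigma> j) h P)) ^^ n) (P0 j)"
  by (induction n) (simp_all add: filter_state_def filter_step_def Let_def)

text \<open>\<open>cov_step_bounds\<close> supplies an invariant of the covariance recursion. Since
  \<open>\<rho>\<close> and \<open>G\<close> are chosen first, the bounds are uniform in step size,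
  coordinate and time.\<close>

lemma gain_bounds:
  fixes s1 s2 KR K :: real
  assumes "0 < s1" "s1 \<le> s2" "0 < KR" "0 \<le> K"
  shows "\<exists>\<rho> G. 0 \<le> \<rho> \<and> \<rho> < 1 \<and> 0 \<le> G \<and>
    (\<forall>h R s P n. 0 < h \<longrightarrow> 0 \<le> R \<longrightarrow> R \<le> KR * h \<longrightarrow> s1 \<le> s \<longrightarrow> s \<le> s2 \<longrightarrow>
      0 \<le> P $ 1 $ 1 \<longrightarrow> P $ 1 $ 1 \<le> K * h \<longrightarrow> \<bar>P $ 0 $ 1\<bar> \<le> K * h\<^sup>2 \<longrightarrow>
      (let \<beta> = gain R (pred_cov s h (((\<lambda>P. update_cov R (pred_cov s h P)) ^^ n) P))
       in 0 \<le> 1 - \<beta> $ 1 \<and> 1 - \<beta> $ 1 \<le> \<rho> \<and> \<bar>\<beta> $ 0\<bar> \<le> G * h))"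
proof -
  define \<rho> where "\<rho> = KR / (s1\<^sup>2 + KR)"
  define D where "D = K + KR + s2\<^sup>2 / 2"
  \<comment> \<open>The second summand is the fixed point of the map taking \<open>b\<close> to
    \<open>\<rho> * (b + D)\<close>, where \<open>D * h\<^sup>2\<close> bounds what a prediction
    adds to the cross covariance. The summand \<open>K\<close> accommodates the initial
    value.\<close>
  define B where "B = K + \<rho> * D / (1 - \<rho>)"
  define G where "G = (B + (K + KR) + s2\<^sup>2 / 2) / s1\<^sup>2"
  have "0 < s1\<^sup>2" using \<open>0 < s1\<close> by simp
  then have "0 \<le> \<rho>" "\<rho> < 1" using \<open>0 < KR\<close> by (simp_all add: \<rho>_def divide_less_eq add_pos_pos)
  have "0 \<le> D" using assms by (simp add: D_def)
  then have "K \<le> B" using \<open>0 \<le> \<rho>\<close> \<open>\<rho> < 1\<close> by (simp add: B_def)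
  have "0 \<le> G" using \<open>K \<le> B\<close> assms by (simp add: G_def)
  have "\<rho> * K \<le> K" using \<open>\<rho> < 1\<close> \<open>0 \<le> K\<close> by (simp add: mult_left_le_one_le \<open>0 \<le> \<rho>\<close>)
  moreover have "\<rho> * (\<rho> * D / (1 - \<rho>)) + \<rho> * D = \<rho> * D / (1 - \<rho>)"
    using \<open>\<rho> < 1\<close> by (simp add: field_simps)
  ultimately have "\<rho> * (B + D) \<le> B" by (simp add: B_def distrib_left)
  then have B: "KR / (s1\<^sup>2 + KR) * (B + (K + KR) + s2\<^sup>2 / 2) \<le> B"
    by (simp add: D_def \<rho>_def add.assoc)
  have "let \<beta> = gain R (pred_cov s h (((\<lambda>P. update_cov R (pred_cov s h P)) ^^ n) P))
       in 0 \<le> 1 - \<beta> $ 1 \<and> 1 - \<beta> $ 1 \<le> \<rho> \<and> \<bar>\<beta> $ 0\<bar> \<le> G * h"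
    if asm: "0 < h" "0 \<le> R" "R \<le> KR * h" "s1 \<le> s" "s \<le> s2"
      "0 \<le> P $ 1 $ 1" "P $ 1 $ 1 \<le> K * h" "\<bar>P $ 0 $ 1\<bar> \<le> K * h\<^sup>2"
    for h R s :: real and P :: "real^2^2" and n
  proof -
    define Q where "Q n = ((\<lambda>P. update_cov R (pred_cov s h P)) ^^ n) P" for n
    \<comment> \<open>The invariant bounds the variance by \<open>(K + KR) * h\<close>:
      \<open>K\<close> covers the initial value and \<open>KR\<close> the values after an
      update.\<close>
    have "KR \<le> K + KR" using \<open>0 \<le> K\<close> by simp
    note step = cov_step_bounds[OF \<open>0 < s1\<close> asm(4,5) \<open>0 < KR\<close> asm(1-3) this B]
    have "0 \<le> Q n $ 1 $ 1 \<and> Q n $ 1 $ 1 \<le> (K + KR) * h \<and> \<bar>Q n $ 0 $ 1\<bar> \<le> B * h\<^sup>2"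
    proof (induction n)
      case 0
      have "K * h \<le> (K + KR) * h" "K * h\<^sup>2 \<le> B * h\<^sup>2"
        using \<open>K \<le> B\<close> \<open>0 < KR\<close> \<open>0 < h\<close> by (auto intro: mult_right_mono)
      then show ?case
        using asm(6) order_trans[OF asm(7)] order_trans[OF asm(8)] by (simp only: Q_def funpow_0)
    next
      case (Suc n)
      have "Q (Suc n) = update_cov R (pred_cov s h (Q n))" by (simp add: Q_def)
      with Suc step(4-6)[of "Q n"] show ?case by auto
    qed
    with step(1-3)[of "Q n"]
    show ?thesis
      by (simp add: Q_def[symmetric] \<rho>_def G_def)
  qed
  with \<open>0 \<le> \<rho>\<close> \<open>\<rho> < 1\<close> \<open>0 \<le> G\<close> show ?thesis by blast
qed

text \<open>For \<open>h \<le> 1\<close>, raising \<open>h\<close> to a real power of at least 1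
  cannot increase it, and infinite \<open>p\<close> gives 0.\<close>

lemma meas_var_bounds:
  assumes "0 < KR" "1 \<le> p" "0 < h" "h \<le> 1"
  shows "0 \<le> meas_var KR p h" "meas_var KR p h \<le> KR * h"
proof -
  show "0 \<le> meas_var KR p h" using assms by (simp add: meas_var_def)
  show "meas_var KR p h \<le> KR * h"
  proof (cases p)
    case (real r)
    then have "1 \<le> r" using \<open>1 \<le> p\<close> by simp
    then have "h powr r \<le> h powr 1" using assms by (intro powr_mono') auto
    then show ?thesis using real assms by (simp add: meas_var_def)
  qed (use assms in \<open>auto simp: meas_var_def\<close>)
qed

section \<open>Propagation of errors\<close>

text \<open>The quantity \<open>e + A h d\<close> with \<open>A = 1 + C / (1 - \<rho>)\<close> grows by a factor \<open>1 + O(h)\<close> per step: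
  the contraction of \<open>d\<close> pays for the term \<open>C h d\<close>.\<close>

lemma coupled_gronwall:
  fixes \<rho> C K T :: real
  assumes "0 \<le> \<rho>" "\<rho> < 1" "0 \<le> C" "0 \<le> K"
  shows "\<exists>K'>0. \<forall>h M e d. 0 < h \<longrightarrow> h \<le> 1 \<longrightarrow> real M * h \<le> T \<longrightarrow>
    (\<forall>n. 0 \<le> e n) \<longrightarrow> (\<forall>n. 0 \<le> d n) \<longrightarrow> e 0 + h * d 0 \<le> K * h \<longrightarrow>
    (\<forall>n<M. e (Suc n) \<le> (1 + C * h) * e n + C * h * d n + C * h\<^sup>2 \<and>
           d (Suc n) \<le> (\<rho> + C * h) * d n + C * h * e n + C * h) \<longrightarrow>
    (\<forall>n\<le>M. e n + h * d n \<le> K' * h)"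
proof -
  \<comment> \<open>Chosen so that \<open>C + A * \<rho> \<le> A\<close>; the summand 1 makes the
    weighted sum dominate \<open>e + h * d\<close>.\<close>
  define A where "A = 1 + C / (1 - \<rho>)"
  define D where "D = (1 + A) * C"
  have "1 \<le> A" using assms by (simp add: A_def)
  have "A * (1 - \<rho>) = 1 - \<rho> + C" using \<open>\<rho> < 1\<close> by (simp add: A_def field_simps)
  then have A: "C + A * \<rho> \<le> A" using \<open>\<rho> < 1\<close> by (simp add: algebra_simps)
  have "0 \<le> D" using \<open>1 \<le> A\<close> \<open>0 \<le> C\<close> by (simp add: D_def)
  show ?thesis
  \<comment> \<open>\<open>(A * K + 1) * h\<close> bounds the initial weighted sum, and
    \<open>exp (D * T)\<close> bounds its growth up to time \<open>T\<close>.\<close>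
  proof (intro exI[of _ "exp (D * T) * (A * K + 1)"] conjI allI impI)
    show "0 < exp (D * T) * (A * K + 1)"
      using \<open>1 \<le> A\<close> \<open>0 \<le> K\<close> by (intro mult_pos_pos add_nonneg_pos) auto
    fix h :: real and M :: nat and e d :: "nat \<Rightarrow> real" and n
    assume "0 < h" "h \<le> 1" "real M * h \<le> T" "\<forall>n. 0 \<le> e n" "\<forall>n. 0 \<le> d n"
      and init: "e 0 + h * d 0 \<le> K * h" and "n \<le> M"
      and rec: "\<forall>n<M. e (Suc n) \<le> (1 + C * h) * e n + C * h * d n + C * h\<^sup>2 \<and>
           d (Suc n) \<le> (\<rho> + C * h) * d n + C * h * e n + C * h"
    \<comment> \<open>The extra summand \<open>h\<close> absorbs the inhomogeneous terms and makes
      the recursion purely multiplicative.\<close>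
    define V where "V n = e n + A * h * d n + h" for n
    have "0 \<le> V n" for n
      using \<open>1 \<le> A\<close> \<open>0 < h\<close> \<open>\<forall>n. 0 \<le> e n\<close> \<open>\<forall>n. 0 \<le> d n\<close> by (simp add: V_def)
    have V_Suc: "V (Suc n) \<le> (1 + D * h) * V n" if "n < M" for n
    proof -
      have "V (Suc n) \<le> ((1 + C * h) * e n + C * h * d n + C * h\<^sup>2)
          + A * h * ((\<rho> + C * h) * d n + C * h * e n + C * h) + h"
        unfolding V_def using rec that \<open>1 \<le> A\<close> \<open>0 < h\<close>
        by (intro add_mono mult_left_mono order.refl) auto
      also have "\<dots> = (1 + C * h) * e n + A * C * h\<^sup>2 * e n + (C + A * \<rho>) * (h * d n)
          + C * h * (A * h * d n) + D * h\<^sup>2 + h"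
        by (simp add: D_def algebra_simps power2_eq_square)
      \<comment> \<open>After this estimate the terms pair up: each pair is \<open>1 + D * h\<close>
        times one summand of \<open>V n\<close>.\<close>
      also have "\<dots> \<le> (1 + C * h) * e n + A * C * h * e n + A * (h * d n)
          + D * h * (A * h * d n) + D * h\<^sup>2 + h"
      proof (intro add_mono mult_right_mono mult_left_mono order.refl A)
        show "h\<^sup>2 \<le> h" using \<open>0 < h\<close> \<open>h \<le> 1\<close> by (simp add: power2_eq_square mult_left_le)
        show "C \<le> D" using \<open>1 \<le> A\<close> \<open>0 \<le> C\<close> by (simp add: D_def distrib_right)
      qed (use \<open>1 \<le> A\<close> \<open>0 \<le> C\<close> \<open>0 < h\<close> \<open>\<forall>n. 0 \<le> e n\<close> \<open>\<forall>n. 0 \<le> d n\<close> in auto)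
      also have "\<dots> = (1 + D * h) * V n"
        by (simp add: V_def D_def algebra_simps power2_eq_square)
      finally show ?thesis .
    qed
    have "V n \<le> (1 + D * h) ^ n * V 0" if "n \<le> M" for n
      using that
    proof (induction n)
      case (Suc n)
      have "V (Suc n) \<le> (1 + D * h) * V n" using Suc by (intro V_Suc) simp
      also have "\<dots> \<le> (1 + D * h) * ((1 + D * h) ^ n * V 0)"
        using Suc \<open>0 \<le> D\<close> \<open>0 < h\<close> by (intro mult_left_mono) auto
      finally show ?case by (simp add: mult.assoc)
    qed simp
    then have "V n \<le> (1 + D * h) ^ n * V 0" using \<open>n \<le> M\<close> .
    also have "\<dots> \<le> exp (D * T) * ((A * K + 1) * h)"
    proof (intro mult_mono)
      have "(1 + D * h) ^ n \<le> exp (D * h) ^ n"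
        using \<open>0 \<le> D\<close> \<open>0 < h\<close> exp_ge_add_one_self by (intro power_mono) auto
      also have "\<dots> = exp (D * (real n * h))" by (simp add: exp_of_nat_mult[symmetric] mult_ac)
      also have "\<dots> \<le> exp (D * T)"
      proof -
        have "real n * h \<le> real M * h" using \<open>n \<le> M\<close> \<open>0 < h\<close> by simp
        then show ?thesis using \<open>real M * h \<le> T\<close> \<open>0 \<le> D\<close> by (simp add: mult_left_mono)
      qed
      finally show "(1 + D * h) ^ n \<le> exp (D * T)" .
      have "e 0 \<le> A * e 0" using mult_right_mono[OF \<open>1 \<le> A\<close>, of "e 0"] \<open>\<forall>n. 0 \<le> e n\<close> by simp
      moreover have "A * (e 0 + h * d 0) \<le> A * (K * h)"
        using init \<open>1 \<le> A\<close> by (intro mult_left_mono) auto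
      ultimately show "V 0 \<le> (A * K + 1) * h" by (simp add: V_def algebra_simps)
    qed (use \<open>0 \<le> V 0\<close> in auto)
    finally have "V n \<le> exp (D * T) * (A * K + 1) * h" by (simp add: mult.assoc)
    moreover have "h * d n \<le> A * h * d n"
      using mult_right_mono[OF \<open>1 \<le> A\<close>, of "h * d n"] \<open>0 < h\<close> \<open>\<forall>n. 0 \<le> d n\<close>
      by (simp add: mult.assoc)
    ultimately show "e n + h * d n \<le> exp (D * T) * (A * K + 1) * h"
      using \<open>0 < h\<close> unfolding V_def by linarith
  qed
qed

section \<open>Effect of one filter step on the mean\<close>

text \<open>The Euclidean norm is monotone in the absolute values of the components, so
  coordinatewise gains cost only a common bound on them.\<close>

lemma norm_coeff_mult_le:
  fixes r :: "real^'d"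
  assumes "\<And>j. \<bar>b j\<bar> \<le> c"
  shows "norm (\<chi> j. b j * r $ j) \<le> c * norm r"
proof -
  have "0 \<le> c" using assms[of undefined] by linarith
  have "norm (\<chi> j. b j * r $ j) \<le> norm (c *\<^sub>R r)"
    using assms \<open>0 \<le> c\<close> by (intro norm_le_componentwise_cart) (auto simp: abs_mult intro: mult_right_mono)
  then show ?thesis using \<open>0 \<le> c\<close> by simp
qed

text \<open>Besides the error \<open>u - y\<close> of the solution component, the defect \<open>f u - v\<close> is tracked
  instead of the error of the derivative component, because the update contracts the defect.\<close>

lemma mean_step_bounds:
  fixes f :: "real^'d \<Rightarrow> real^'d" and u v y y' :: "real^'d" and b0 b1 :: "'d \<Rightarrow> real"
  assumes lip: "\<And>a b. norm (f a - f b) \<le> L * norm (a - b)"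
    and pos: "0 \<le> L" "0 \<le> G" "0 \<le> B" "0 \<le> \<rho>" "\<rho> \<le> 1" "0 < h" "h \<le> 1"
    and b0: "\<And>j. \<bar>b0 j\<bar> \<le> G * h"
    and b1: "\<And>j. 0 \<le> 1 - b1 j" "\<And>j. 1 - b1 j \<le> \<rho>"
    and y: "norm (f y) \<le> B" "norm (y' - y - h *\<^sub>R f y) \<le> L * B * h\<^sup>2"
  defines "r \<equiv> f (u + h *\<^sub>R v) - v"
    and "e \<equiv> norm (u - y)" and "d \<equiv> norm (f u - v)"
    and "C \<equiv> (L * G + L + L\<^sup>2 * G) + (L * G + 1) * (L * L) + (L * G + 1) * (L * B)
      + (L + G * L * L) + (1 + G * (1 + L)) + (G * L * B + L * B)"
  defines "u' \<equiv> \<chi> j. u $ j + h * v $ j + b0 j * r $ j" and "v' \<equiv> \<chi> j. v $ j + b1 j * r $ j"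
  shows "norm (u' - y') \<le> (1 + C * h) * e + C * h * d + C * h\<^sup>2"
    and "norm (f u' - v') \<le> (\<rho> + C * h) * d + C * h * e + C * h"
proof -
  have "0 \<le> e" "0 \<le> d" by (simp_all add: e_def d_def)
  \<comment> \<open>The first three summands of \<open>C\<close> are the coefficients of
    \<open>h * d\<close>, \<open>h * e\<close> and \<open>h\<close> in the defect bound, the last
    three those of \<open>h * e\<close>, \<open>h * d\<close> and \<open>h\<^sup>2\<close> in the
    error bound.\<close>
  have "0 \<le> L * G + L + L\<^sup>2 * G" "0 \<le> (L * G + 1) * (L * L)" "0 \<le> (L * G + 1) * (L * B)"
    "0 \<le> L + G * L * L" "0 \<le> 1 + G * (1 + L)" "0 \<le> G * L * B + L * B"
    using pos by simp_all
  then have C: "L * G + L + L\<^sup>2 * G \<le> C" "(L * G + 1) * (L * L) \<le> C" "(L * G + 1) * (L * B) \<le> C"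
    "L + G * L * L \<le> C" "1 + G * (1 + L) \<le> C" "G * L * B + L * B \<le> C"
    unfolding C_def by linarith+
  \<comment> \<open>\<open>B\<close> bounds \<open>f\<close> only at the exact value
    \<open>y\<close>; at \<open>u\<close> the Lipschitz bound adds a multiple of the error.\<close>
  have fu: "norm (f u) \<le> B + L * e"
    using lip[of u y] y(1) norm_triangle_ineq2[of "f u" "f y"] by (simp add: e_def)
  have "norm v \<le> d + norm (f u)"
    using norm_triangle_ineq2[of v "f u"] by (simp add: d_def norm_minus_commute)
  then have v_le: "norm v \<le> d + (B + L * e)" using fu by linarith
  \<comment> \<open>The residual is the old defect plus the change of \<open>f\<close> over the
    prediction, which is small with \<open>h\<close>.\<close>
  have "r = (f (u + h *\<^sub>R v) - f u) + (f u - v)" by (simp add: r_def)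
  then have "norm r \<le> norm (f (u + h *\<^sub>R v) - f u) + d" unfolding d_def by (metis norm_triangle_ineq)
  also have "\<dots> \<le> L * (h * norm v) + d" using lip[of "u + h *\<^sub>R v" u] \<open>0 < h\<close> by simp
  also have "\<dots> \<le> L * (h * (d + (B + L * e))) + d"
    using v_le pos by (intro add_mono mult_left_mono order.refl) auto
  finally have r_le: "norm r \<le> (1 + L * h) * d + L * h * (B + L * e)" by (simp add: algebra_simps)
  have w0: "norm (\<chi> j. b0 j * r $ j) \<le> G * h * norm r" by (intro norm_coeff_mult_le b0)
  have w1: "norm (\<chi> j. (1 - b1 j) * r $ j) \<le> \<rho> * norm r"
    using b1 by (intro norm_coeff_mult_le) (auto simp: abs_of_nonneg)
  have u': "u' = (u + h *\<^sub>R v) + (\<chi> j. b0 j * r $ j)"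
    by (simp add: u'_def vec_eq_iff)
  \<comment> \<open>Source of the contraction: after the update only the fraction
    \<open>1 - b1 j\<close> of the residual remains.\<close>
  have v': "v' = f (u + h *\<^sub>R v) - (\<chi> j. (1 - b1 j) * r $ j)"
    by (simp add: v'_def vec_eq_iff r_def algebra_simps)

  \<comment> \<open>The step is read as an Euler step for \<open>f\<close>, perturbed by the defect,
    the gain term and the Euler remainder of the solution.\<close>
  have "u' - y' = (u - y) + h *\<^sub>R (f u - f y) - h *\<^sub>R (f u - v) + (\<chi> j. b0 j * r $ j)
      - (y' - y - h *\<^sub>R f y)"
    by (simp add: u' algebra_simps)
  then have "norm (u' - y') \<le> norm (u - y) + norm (h *\<^sub>R (f u - f y)) + norm (h *\<^sub>R (f u - v))
      + norm (\<chi> j. b0 j * r $ j) + norm (y' - y - h *\<^sub>R f y)"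
    by (smt (verit) norm_triangle_ineq norm_triangle_ineq4)
  also have "\<dots> \<le> e + h * (L * e) + h * d + G * h * norm r + L * B * h\<^sup>2"
    using lip[of u y] w0 y(2) \<open>0 < h\<close>
    by (intro add_mono) (auto simp: e_def d_def)
  \<comment> \<open>Inner factors \<open>h\<close> become 1, except beside \<open>B\<close>, where a
    second power of \<open>h\<close> is needed.\<close>
  also have "\<dots> \<le> e + h * (L * e) + h * d
      + G * h * ((1 + L * 1) * d + L * h * B + L * 1 * L * e) + L * B * h\<^sup>2"
  proof -
    have "norm r \<le> (1 + L * h) * d + L * h * B + L * h * L * e"
      using r_le by (simp add: algebra_simps)
    also have "\<dots> \<le> (1 + L * 1) * d + L * h * B + L * 1 * L * e"
      using pos \<open>0 \<le> e\<close> \<open>0 \<le> d\<close> by (intro add_mono mult_right_mono mult_left_mono order.refl) auto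
    finally show ?thesis using pos by (intro add_mono mult_left_mono order.refl) auto
  qed
  also have "\<dots> = e + (L + G * L * L) * (h * e) + (1 + G * (1 + L)) * (h * d)
      + (G * L * B + L * B) * h\<^sup>2"
    by (simp add: algebra_simps power2_eq_square)
  also have "\<dots> \<le> e + C * (h * e) + C * (h * d) + C * h\<^sup>2"
    using pos \<open>0 \<le> e\<close> \<open>0 \<le> d\<close>
    by (intro add_mono mult_right_mono C order.refl) auto
  finally show "norm (u' - y') \<le> (1 + C * h) * e + C * h * d + C * h\<^sup>2"
    by (simp add: algebra_simps)

  have "f u' - v' = (f u' - f (u + h *\<^sub>R v)) + (\<chi> j. (1 - b1 j) * r $ j)" by (simp add: v')
  then have "norm (f u' - v') \<le> norm (f u' - f (u + h *\<^sub>R v)) + norm (\<chi> j. (1 - b1 j) * r $ j)"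
    by (metis norm_triangle_ineq)
  also have "\<dots> \<le> L * (G * h * norm r) + \<rho> * norm r"
  proof -
    have "norm (f u' - f (u + h *\<^sub>R v)) \<le> L * norm (\<chi> j. b0 j * r $ j)"
      using lip[of u' "u + h *\<^sub>R v"] by (simp add: u')
    also have "\<dots> \<le> L * (G * h * norm r)" using w0 \<open>0 \<le> L\<close> by (rule mult_left_mono)
    finally show ?thesis using w1 by (rule add_mono)
  qed
  also have "\<dots> = (L * G * h + \<rho>) * norm r" by (simp add: algebra_simps)
  also have "\<dots> \<le> (L * G * h + \<rho>) * ((1 + L * h) * d + L * h * (B + L * e))"
    using r_le pos by (intro mult_left_mono) auto
  also have "\<dots> = \<rho> * d + (L * G + \<rho> * L + L\<^sup>2 * G * h) * (h * d)
      + (L * G * h + \<rho>) * (L * L) * (h * e) + (L * G * h + \<rho>) * (L * B) * h"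
    by (simp add: algebra_simps power2_eq_square)
  \<comment> \<open>In the coefficients of the higher-order terms \<open>\<rho>\<close> and
    \<open>h\<close> become 1; the leading \<open>\<rho> * d\<close> keeps its contraction.\<close>
  also have "\<dots> \<le> \<rho> * d + (L * G + 1 * L + L\<^sup>2 * G * 1) * (h * d)
      + (L * G * 1 + 1) * (L * L) * (h * e) + (L * G * 1 + 1) * (L * B) * h"
    using pos \<open>0 \<le> e\<close> \<open>0 \<le> d\<close>
    by (intro add_mono mult_right_mono mult_left_mono order.refl) auto
  also have "\<dots> \<le> \<rho> * d + C * (h * d) + C * (h * e) + C * h"
    unfolding mult_1 mult_1_right using pos \<open>0 \<le> e\<close> \<open>0 \<le> d\<close>
    by (intro add_mono mult_right_mono C order.refl) auto
  finally show "norm (f u' - v') \<le> (\<rho> + C * h) * d + C * h * e + C * h"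
    by (simp add: algebra_simps)
qed

lemma filter_state_Suc_rows:
  fixes f :: "real^'d \<Rightarrow> real^'d" and \<sigma> :: "'d \<Rightarrow> real" and R h :: real
    and m0 :: "real^'d^2" and P0 :: "'d \<Rightarrow> real^2^2"
  defines "S \<equiv> filter_state f \<sigma> R h m0 P0"
  defines "u \<equiv> \<lambda>n. fst (S n) $ 0" and "v \<equiv> \<lambda>n. fst (S n) $ 1"
    and "\<beta> \<equiv> \<lambda>n j. gain R (pred_cov (\<sigma> j) h (snd (S n) j))"
    and "r \<equiv> \<lambda>n. f (fst (S n) $ 0 + h *\<^sub>R fst (S n) $ 1) - fst (S n) $ 1"
  shows "u (Suc n) = (\<chi> j. u n $ j + h * v n $ j + \<beta> n j $ 0 * r n $ j)"
    and "v (Suc n) = (\<chi> j. v n $ j + \<beta> n j $ 1 * r n $ j)"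
proof -
  have "pred_mean h m $ 0 = m $ 0 + h *\<^sub>R m $ 1" "pred_mean h m $ 1 = m $ 1" for m :: "real^'d^2"
    by (simp_all add: pred_mean_def trans_mat_def mat22_def matrix_matrix_mult_def UNIV_2_eq vec_eq_iff)
  note this [simp]
  have "fst (S (Suc n)) = (\<chi> i j. pred_mean h (fst (S n)) $ i $ j + \<beta> n j $ i * r n $ j)"
    by (simp add: \<beta>_def r_def S_def filter_state_def filter_step_def Let_def residual_def)
  then show "u (Suc n) = (\<chi> j. u n $ j + h * v n $ j + \<beta> n j $ 0 * r n $ j)"
    and "v (Suc n) = (\<chi> j. v n $ j + \<beta> n j $ 1 * r n $ j)"
    by (simp_all add: u_def v_def)
qed

section \<open>Local error of the Euler step along the exact solution\<close>

text \<open>The mean value inequality is used twice: \<open>x\<close> moves by at most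
  \<open>B * h\<close>, so its derivative changes by at most \<open>L * B * h\<close>. The Lipschitz
  bound takes the place of a second derivative.\<close>

lemma ode_euler_remainder:
  fixes f :: "'a::real_normed_vector \<Rightarrow> 'a"
  assumes lip: "\<And>a b. norm (f a - f b) \<le> L * norm (a - b)" and "0 \<le> L"
    and deriv: "\<And>t. t \<in> {0..T} \<Longrightarrow> (x has_vector_derivative f (x t)) (at t within {0..T})"
    and B: "\<And>t. t \<in> {0..T} \<Longrightarrow> norm (f (x t)) \<le> B"
    and t: "0 \<le> t" "0 \<le> h" "t + h \<le> T"
  shows "norm (x (t + h) - x t - h *\<^sub>R f (x t)) \<le> L * B * h\<^sup>2"
proof -
  have sub: "{t..t + h} \<subseteq> {0..T}" using t by auto
  have deriv': "(x has_vector_derivative f (x s)) (at s within {t..t + h})" if "s \<in> {t..t + h}" for s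
    using deriv[of s] that sub has_vector_derivative_within_subset by blast
  have "0 \<le> B" using B[of t] t norm_ge_zero[of "f (x t)"] by (smt (verit) atLeastAtMost_iff)
  have x_le: "norm (x s - x t) \<le> B * h" if s: "s \<in> {t..t + h}" for s
  proof -
    have "norm (x s - x t) \<le> B * norm (s - t)"
    proof (rule differentiable_bound[of "{t..t + h}" x "\<lambda>s c. c *\<^sub>R f (x s)"])
      show "(x has_derivative (\<lambda>c. c *\<^sub>R f (x s))) (at s within {t..t + h})" if "s \<in> {t..t + h}" for s
        using deriv'[OF that] by (simp add: has_vector_derivative_def)
      show "onorm (\<lambda>c. c *\<^sub>R f (x s)) \<le> B" if "s \<in> {t..t + h}" for s
        using B[of s] that sub by (intro onorm_le) (auto simp: mult.commute[of B] intro: mult_left_mono)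
    qed (use s t in auto)
    also have "\<dots> \<le> B * h" using s \<open>0 \<le> B\<close> by (intro mult_left_mono) auto
    finally show ?thesis .
  qed
  \<comment> \<open>With the linear part removed, the increment of \<open>z\<close> is the remainder
    and its derivative is \<open>f (x s) - f (x t)\<close>.\<close>
  define z where "z s = x s - s *\<^sub>R f (x t)" for s
  have "norm (z (t + h) - z t) \<le> L * (B * h) * norm (t + h - t)"
  proof (rule differentiable_bound[of "{t..t + h}" z "\<lambda>s c. c *\<^sub>R (f (x s) - f (x t))"])
    show "(z has_derivative (\<lambda>c. c *\<^sub>R (f (x s) - f (x t)))) (at s within {t..t + h})"
      if "s \<in> {t..t + h}" for s
      using deriv'[OF that] unfolding z_def has_vector_derivative_def
      by (auto intro!: derivative_eq_intros simp: scaleR_diff_right)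
    show "onorm (\<lambda>c. c *\<^sub>R (f (x s) - f (x t))) \<le> L * (B * h)" if "s \<in> {t..t + h}" for s
    proof (rule onorm_le)
      fix c :: real
      have "norm (f (x s) - f (x t)) \<le> L * (B * h)"
        using lip[of "x s" "x t"] mult_left_mono[OF x_le[OF that] \<open>0 \<le> L\<close>] by linarith
      then show "norm (c *\<^sub>R (f (x s) - f (x t))) \<le> L * (B * h) * norm c"
        by (simp add: mult.commute[of _ "\<bar>c\<bar>"] mult_left_mono)
    qed
  qed (use t in auto)
  moreover have "z (t + h) - z t = x (t + h) - x t - h *\<^sub>R f (x t)"
    by (simp add: z_def algebra_simps)
  ultimately show ?thesis using t by (simp add: power2_eq_square mult_ac)
qed

section \<open>First-order convergence on the whole interval\<close>

theorem theorem14: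
  fixes N :: "real^'d \<Rightarrow> real"
    and f :: "real^'d \<Rightarrow> real^'d"
    and x x' :: "real \<Rightarrow> real^'d"
    and x0 :: "real^'d"
    and \<sigma> :: "'d \<Rightarrow> real"
    and m0 :: "real \<Rightarrow> real^'d^2"
    and P0 :: "real \<Rightarrow> 'd \<Rightarrow> real^2^2"
    and T L K0 KR :: real
    and p :: ereal
  assumes "is_norm N"
    and "T > 0"
    and "\<And>j. \<sigma> j > 0"
    and "\<And>t. t \<in> {0..T} \<Longrightarrow> (x has_vector_derivative x' t) (at t within {0..T})"
    and "\<And>t. t \<in> {0..T} \<Longrightarrow> x' t = f (x t)"
    and "x 0 = x0"
    and "C1_map f"
    and "L > 0"
    and "\<And>i a. N (partial_deriv i f a) \<le> L"
    and "\<And>a b. N (f a - f b) \<le> L * N (a - b)"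
    and "\<And>i a b. N (partial_deriv i f a - partial_deriv i f b) \<le> L * N (a - b)"
    and "K0 > 0"
    and "\<And>h j. \<lbrakk>h > 0; T / h \<in> \<nat>\<rbrakk> \<Longrightarrow> sym_psd (P0 h j)"
    and "\<And>h k l. \<lbrakk>h > 0; T / h \<in> \<nat>; k \<in> {0,1}; l \<in> {0,1}\<rbrakk> \<Longrightarrow>
           N (cov_entry (P0 h) (of_nat k) (of_nat l)) \<le> K0 * h ^ (3 - k - l)"
    and "\<And>h. \<lbrakk>h > 0; T / h \<in> \<nat>\<rbrakk> \<Longrightarrow> N (m0 h $ 0 - x 0) \<le> K0 * h\<^sup>2"
    and "\<And>h. \<lbrakk>h > 0; T / h \<in> \<nat>\<rbrakk> \<Longrightarrow> N (m0 h $ 1 - x' 0) \<le> K0 * h"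
    and "KR > 0"
    and "1 \<le> p"
  shows "\<exists>K > 0. \<exists>h0 > 0. \<forall>h M. 0 < h \<and> h < h0 \<and> T / h = real M \<longrightarrow>
    (let \<epsilon> = filter_error f \<sigma> (meas_var KR p h) h (m0 h) (P0 h) x x' in
       (MAX n\<in>{0..M}. N (\<epsilon> n $ 0)) \<le> (MAX n\<in>{0..M}. step_norm N h (\<epsilon> n)) \<and>
       (MAX n\<in>{0..M}. step_norm N h (\<epsilon> n)) \<le> K * h)"
proof -
  obtain c C where "c > 0" "C > 0" and le_N: "norm a \<le> c * N a" and N_le: "N a \<le> C * norm a" for a
    using is_norm_equivalent[OF assms(1)] by metis
  \<comment> \<open>The Lipschitz constant of \<open>f\<close> in the Euclidean norm.\<close>
  define \<Lambda> where "\<Lambda> = c * L * C"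
  have "0 \<le> \<Lambda>" using \<open>c > 0\<close> \<open>C > 0\<close> \<open>L > 0\<close> by (simp add: \<Lambda>_def)
  have lip: "norm (f a - f b) \<le> \<Lambda> * norm (a - b)" for a b
  proof -
    have "norm (f a - f b) \<le> c * N (f a - f b)" by (rule le_N)
    also have "\<dots> \<le> c * (L * N (a - b))" using assms(10) \<open>c > 0\<close> by simp
    also have "\<dots> \<le> c * (L * (C * norm (a - b)))" using N_le \<open>c > 0\<close> \<open>L > 0\<close> by simp
    finally show ?thesis by (simp add: \<Lambda>_def mult.assoc)
  qed
  have deriv: "(x has_vector_derivative f (x t)) (at t within {0..T})" if "t \<in> {0..T}" for t
    using assms(4,5) that by fastforce
  have "continuous_on {0..T} x"
    using assms(4) has_vector_derivative_continuous continuous_on_eq_continuous_within by blast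
  moreover have "\<Lambda>-lipschitz_on UNIV f"
    using lip \<open>0 \<le> \<Lambda>\<close> by (intro lipschitz_onI) (auto simp: dist_norm)
  then have "continuous_on UNIV f" by (rule lipschitz_on_continuous_on)
  ultimately have "continuous_on {0..T} (\<lambda>t. f (x t))"
    by (metis continuous_on_compose2 subset_UNIV)
  then have "bounded ((\<lambda>t. f (x t)) ` {0..T})"
    by (simp add: compact_continuous_image compact_imp_bounded)
  then obtain B where "0 < B" and B: "\<And>t. t \<in> {0..T} \<Longrightarrow> norm (f (x t)) \<le> B"
    unfolding bounded_pos by auto
  \<comment> \<open>Common bounds for the finitely many scales make the gain bounds independent of
    the coordinate.\<close>
  define s1 s2 where "s1 = Min (range \<sigma>)" and "s2 = Max (range \<sigma>)"
  have \<sigma>: "s1 \<le> \<sigma> j" "\<sigma> j \<le> s2" for j by (simp_all add: s1_def s2_def)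
  have "0 < s1" using assms(3) by (simp add: s1_def)
  have "s1 \<le> s2" using \<sigma> order_trans by blast
  define K1 where "K1 = c * K0"
  have "0 \<le> K1" using \<open>c > 0\<close> \<open>K0 > 0\<close> by (simp add: K1_def)
  obtain \<rho> G where "0 \<le> \<rho>" "\<rho> < 1" "0 \<le> G" and gain:
    "\<And>h R s P n. \<lbrakk>0 < h; 0 \<le> R; R \<le> KR * h; s1 \<le> s; s \<le> s2;
      0 \<le> P $ 1 $ 1; P $ 1 $ 1 \<le> K1 * h; \<bar>P $ 0 $ 1\<bar> \<le> K1 * h\<^sup>2\<rbrakk> \<Longrightarrow>
      let \<beta> = gain R (pred_cov s h (((\<lambda>P. update_cov R (pred_cov s h P)) ^^ n) P))
       in 0 \<le> 1 - \<beta> $ 1 \<and> 1 - \<beta> $ 1 \<le> \<rho> \<and> \<bar>\<beta> $ 0\<bar> \<le> G * h"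
    using gain_bounds[OF \<open>0 < s1\<close> \<open>s1 \<le> s2\<close> \<open>KR > 0\<close> \<open>0 \<le> K1\<close>] by metis
  \<comment> \<open>The constant \<open>C\<close> of \<open>mean_step_bounds\<close> with
    \<open>L\<close> replaced by \<open>\<Lambda>\<close>.\<close>
  define D where "D = (\<Lambda> * G + \<Lambda> + \<Lambda>\<^sup>2 * G) + (\<Lambda> * G + 1) * (\<Lambda> * \<Lambda>) + (\<Lambda> * G + 1) * (\<Lambda> * B)
    + (\<Lambda> + G * \<Lambda> * \<Lambda>) + (1 + G * (1 + \<Lambda>)) + (G * \<Lambda> * B + \<Lambda> * B)"
  have "0 \<le> D" using \<open>0 \<le> \<Lambda>\<close> \<open>0 \<le> G\<close> \<open>0 < B\<close> by (simp add: D_def)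
  \<comment> \<open>\<open>K1 * h\<close> bounds the initial error, and
    \<open>(\<Lambda> + 1) * K1\<close> the initial defect.\<close>
  define K2 where "K2 = K1 + (\<Lambda> + 1) * K1"
  have "0 \<le> K2" using \<open>0 \<le> K1\<close> \<open>0 \<le> \<Lambda>\<close> by (simp add: K2_def)
  obtain K3 where "0 < K3" and K3: "\<And>h M e d n. \<lbrakk>0 < h; h \<le> 1; real M * h \<le> T;
      \<And>n. 0 \<le> e n; \<And>n. 0 \<le> d n; e 0 + h * d 0 \<le> K2 * h;
      \<And>n. n < M \<Longrightarrow> e (Suc n) \<le> (1 + D * h) * e n + D * h * d n + D * h\<^sup>2;
      \<And>n. n < M \<Longrightarrow> d (Suc n) \<le> (\<rho> + D * h) * d n + D * h * e n + D * h; n \<le> M\<rbrakk>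
      \<Longrightarrow> e n + h * d n \<le> K3 * h"
    using coupled_gronwall[OF \<open>0 \<le> \<rho>\<close> \<open>\<rho> < 1\<close> \<open>0 \<le> D\<close> \<open>0 \<le> K2\<close>, of T] by metis
  \<comment> \<open>All constants are fixed by now, and 1 serves as \<open>h0\<close>.\<close>
  have "let \<epsilon> = filter_error f \<sigma> (meas_var KR p h) h (m0 h) (P0 h) x x' in
       (MAX n\<in>{0..M}. N (\<epsilon> n $ 0)) \<le> (MAX n\<in>{0..M}. step_norm N h (\<epsilon> n)) \<and>
       (MAX n\<in>{0..M}. step_norm N h (\<epsilon> n)) \<le> C * (1 + \<Lambda>) * K3 * h"
    if hM: "0 < h \<and> h < 1 \<and> T / h = real M" for h M
  proof -
    from hM have "0 < h" "h \<le> 1" and T: "T = real M * h" by (auto simp: field_simps)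
    have Nats: "T / h \<in> \<nat>" using hM by simp
    define R where "R = meas_var KR p h"
    have R: "0 \<le> R" "R \<le> KR * h"
      using meas_var_bounds[OF \<open>KR > 0\<close> \<open>1 \<le> p\<close> \<open>0 < h\<close> \<open>h \<le> 1\<close>] by (simp_all add: R_def)
    define S where "S = filter_state f \<sigma> R h (m0 h) (P0 h)"
    define u v where "u n = fst (S n) $ 0" and "v n = fst (S n) $ 1" for n
    define y where "y n = x (real n * h)" for n
    define e d where "e n = norm (u n - y n)" and "d n = norm (f (u n) - v n)" for n
    define \<beta> where "\<beta> n j = gain R (pred_cov (\<sigma> j) h (snd (S n) j))" for n j
    have time: "real n * h \<in> {0..T}" if "n \<le> M" for n
      using that \<open>0 < h\<close> by (simp add: T)
    have P_bounds: "0 \<le> P0 h j $ 1 $ 1" "P0 h j $ 1 $ 1 \<le> K1 * h" "\<bar>P0 h j $ 0 $ 1\<bar> \<le> K1 * h\<^sup>2" for j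
    proof -
      \<comment> \<open>Testing semidefiniteness with a unit vector extracts the diagonal
        entry.\<close>
      have "0 \<le> axis 1 1 \<bullet> (P0 h j *v axis 1 1)"
        using assms(13)[OF \<open>0 < h\<close> Nats] unfolding sym_psd_def by blast
      then show "0 \<le> P0 h j $ 1 $ 1"
        by (simp add: matrix_vector_mul_component inner_axis inner_axis' row_def)
      have entry: "\<bar>P0 h j $ k $ l\<bar> \<le> c * N (cov_entry (P0 h) k l)" for k l
        using order_trans[OF component_le_norm_cart le_N, of "cov_entry (P0 h) k l" j]
        by (simp add: cov_entry_def)
      have "N (cov_entry (P0 h) 1 1) \<le> K0 * h" "N (cov_entry (P0 h) 0 1) \<le> K0 * h\<^sup>2"
        using assms(14)[OF \<open>0 < h\<close> Nats, of 1 1] assms(14)[OF \<open>0 < h\<close> Nats, of 0 1]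
        by (simp_all add: numeral_2_eq_2 numeral_3_eq_3)
      then have "c * N (cov_entry (P0 h) 1 1) \<le> K1 * h" "c * N (cov_entry (P0 h) 0 1) \<le> K1 * h\<^sup>2"
        using \<open>c > 0\<close> by (simp_all add: K1_def mult.assoc)
      then show "P0 h j $ 1 $ 1 \<le> K1 * h" "\<bar>P0 h j $ 0 $ 1\<bar> \<le> K1 * h\<^sup>2"
        using entry[of 1 1] entry[of 0 1] by linarith+
    qed
    have \<beta>_bounds: "0 \<le> 1 - \<beta> n j $ 1" "1 - \<beta> n j $ 1 \<le> \<rho>" "\<bar>\<beta> n j $ 0\<bar> \<le> G * h" for n j
      using gain[OF \<open>0 < h\<close> R \<sigma>[of j] P_bounds[of j], of n]
      by (simp_all add: \<beta>_def S_def snd_filter_state Let_def)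
    have step: "e (Suc n) \<le> (1 + D * h) * e n + D * h * d n + D * h\<^sup>2"
      "d (Suc n) \<le> (\<rho> + D * h) * d n + D * h * e n + D * h" if "n < M" for n
    proof -
      have "norm (y (Suc n) - y n - h *\<^sub>R f (y n)) \<le> \<Lambda> * B * h\<^sup>2"
        using ode_euler_remainder[OF lip \<open>0 \<le> \<Lambda>\<close> deriv B, of "real n * h" h] \<open>0 < h\<close>
          time[of "Suc n"] that
        by (simp add: y_def algebra_simps)
      moreover have "norm (f (y n)) \<le> B" using time[of n] that B by (simp add: y_def)
      ultimately show "e (Suc n) \<le> (1 + D * h) * e n + D * h * d n + D * h\<^sup>2"
        "d (Suc n) \<le> (\<rho> + D * h) * d n + D * h * e n + D * h"
        using mean_step_bounds[where u = "u n" and v = "v n" and y = "y n" and y' = "y (Suc n)"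
            and ?b0.0 = "\<lambda>j. \<beta> n j $ 0" and ?b1.0 = "\<lambda>j. \<beta> n j $ 1", OF lip \<open>0 \<le> \<Lambda>\<close> \<open>0 \<le> G\<close> less_imp_le[OF \<open>0 < B\<close>] \<open>0 \<le> \<rho>\<close>
            less_imp_le[OF \<open>\<rho> < 1\<close>] \<open>0 < h\<close> \<open>h \<le> 1\<close> \<beta>_bounds(3,1,2)]
          filter_state_Suc_rows[of f \<sigma> R h "m0 h" "P0 h" n]
        unfolding e_def d_def D_def u_def v_def \<beta>_def S_def by simp_all
    qed
    have init: "e 0 + h * d 0 \<le> K2 * h"
    proof -
      have S0: "u 0 = m0 h $ 0" "v 0 = m0 h $ 1" by (simp_all add: u_def v_def S_def filter_state_def)
      have "norm (u 0 - x 0) \<le> c * (K0 * h\<^sup>2)"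
        using order_trans[OF le_N mult_left_mono[OF assms(15)[OF \<open>0 < h\<close> Nats]]] \<open>c > 0\<close> S0 by simp
      then have "e 0 \<le> K1 * h\<^sup>2" by (simp add: e_def y_def K1_def mult.assoc)
      also have "\<dots> \<le> K1 * h"
        using \<open>0 < h\<close> \<open>h \<le> 1\<close> \<open>0 \<le> K1\<close> by (intro mult_left_mono) (auto simp: power2_eq_square mult_left_le)
      finally have e0: "e 0 \<le> K1 * h" .
      have "norm (v 0 - x' 0) \<le> c * (K0 * h)"
        using order_trans[OF le_N mult_left_mono[OF assms(16)[OF \<open>0 < h\<close> Nats]]] \<open>c > 0\<close> S0 by simp
      then have "norm (v 0 - f (x 0)) \<le> K1 * h"
        using assms(5)[of 0] \<open>T > 0\<close> by (simp add: K1_def mult.assoc)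
      moreover have "norm (f (u 0) - f (x 0)) \<le> \<Lambda> * (K1 * h)"
        using lip[of "u 0" "x 0"] mult_left_mono[OF e0 \<open>0 \<le> \<Lambda>\<close>] by (simp add: e_def y_def)
      \<comment> \<open>Since \<open>x' 0 = f (x 0)\<close>, the initial defect is controlled by the
        two initial errors.\<close>
      moreover have "d 0 \<le> norm (f (u 0) - f (x 0)) + norm (v 0 - f (x 0))"
        using norm_triangle_ineq4[of "f (u 0) - f (x 0)" "v 0 - f (x 0)"] by (simp add: d_def)
      ultimately have "d 0 \<le> (\<Lambda> + 1) * (K1 * h)" by (simp add: distrib_right)
      also have "\<dots> \<le> (\<Lambda> + 1) * K1"
        using \<open>0 \<le> \<Lambda>\<close> \<open>0 \<le> K1\<close> \<open>h \<le> 1\<close> by (intro mult_left_mono) (auto simp: mult_left_le)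
      finally have "h * d 0 \<le> h * ((\<Lambda> + 1) * K1)" using \<open>0 < h\<close> by simp
      then show ?thesis using e0 by (simp add: K2_def algebra_simps)
    qed
    define \<epsilon> where "\<epsilon> = filter_error f \<sigma> (meas_var KR p h) h (m0 h) (P0 h) x x'"
    have \<epsilon>: "\<epsilon> n $ 0 = u n - y n" "\<epsilon> n $ 1 = v n - x' (real n * h)" for n
      by (simp_all add: \<epsilon>_def filter_error_def rows2_def u_def v_def S_def R_def y_def)
    have "step_norm N h (\<epsilon> n) \<le> C * (1 + \<Lambda>) * K3 * h" if "n \<le> M" for n
    proof -
      have "x' (real n * h) = f (y n)" using assms(5) time[OF that] by (simp add: y_def)
      \<comment> \<open>This turns the defect back into the error of the derivative
        component.\<close>
      moreover have "norm (v n - f (y n)) \<le> norm (f (u n) - f (y n)) + d n"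
        using norm_triangle_ineq4[of "f (u n) - f (y n)" "f (u n) - v n"] by (simp add: d_def)
      ultimately have "norm (\<epsilon> n $ 1) \<le> \<Lambda> * e n + d n"
        using lip[of "u n" "y n"] by (simp add: \<epsilon> e_def)
      then have "N (\<epsilon> n $ 1) \<le> C * (\<Lambda> * e n + d n)"
        using order_trans[OF N_le mult_left_mono] \<open>C > 0\<close> by simp
      then have "step_norm N h (\<epsilon> n) \<le> C * e n + h * (C * (\<Lambda> * e n + d n))"
        unfolding step_norm_def using N_le[of "\<epsilon> n $ 0"] \<open>0 < h\<close>
        by (intro add_mono mult_left_mono) (auto simp: \<epsilon> e_def)
      also have "\<dots> = C * (e n + h * (\<Lambda> * e n) + 1 * (h * d n))" by (simp add: algebra_simps)
      also have "\<dots> \<le> C * (e n + 1 * (\<Lambda> * e n) + (1 + \<Lambda>) * (h * d n))"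
        using \<open>C > 0\<close> \<open>0 < h\<close> \<open>h \<le> 1\<close> \<open>0 \<le> \<Lambda>\<close>
        by (intro mult_left_mono add_mono mult_right_mono order.refl) (auto simp: e_def d_def)
      also have "\<dots> = C * (1 + \<Lambda>) * (e n + h * d n)" by (simp add: algebra_simps)
      also have "\<dots> \<le> C * (1 + \<Lambda>) * (K3 * h)"
        using K3[of h M e d n] step init T \<open>0 < h\<close> \<open>h \<le> 1\<close> \<open>0 \<le> \<Lambda>\<close> \<open>C > 0\<close> that
        by (intro mult_left_mono) (auto simp: e_def d_def)
      finally show ?thesis by (simp add: mult.assoc)
    qed
    then have upper: "(MAX n\<in>{0..M}. step_norm N h (\<epsilon> n)) \<le> C * (1 + \<Lambda>) * K3 * h"
      by (intro Max.boundedI) auto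
    have le: "N (\<epsilon> n $ 0) \<le> step_norm N h (\<epsilon> n)" for n
      using assms(1) \<open>0 < h\<close> by (simp add: step_norm_def is_norm_def)
    have "N (\<epsilon> n $ 0) \<le> (MAX n\<in>{0..M}. step_norm N h (\<epsilon> n))" if "n \<in> {0..M}" for n
      using that by (intro order_trans[OF le Max_ge]) auto
    then have "(MAX n\<in>{0..M}. N (\<epsilon> n $ 0)) \<le> (MAX n\<in>{0..M}. step_norm N h (\<epsilon> n))"
      by (intro Max.boundedI) auto
    with upper show ?thesis by (simp add: \<epsilon>_def[symmetric] Let_def)
  qed
  moreover have "0 < C * (1 + \<Lambda>) * K3" using \<open>C > 0\<close> \<open>0 \<le> \<Lambda>\<close> \<open>0 < K3\<close> by simp
  ultimately show ?thesis using zero_less_one by blast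
qed

end
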